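(* Let $n\ge 1$ and let $\pi \in S_n$ be a permutation with inversion graph $G_\pi$. Every reduced word for $\pi$ contains exactly $\beta(G_\pi)$ repeated letters.
   Context: Inversion graph: $G_\pi$ is the simple graph with vertex set $[n]=\{1,\dots,n\}$ (the values of $\pi$) in which values $a<b$ are adjacent if and only if $b$ appears to the left of $a$ in the one-line notation $\pi(1)\cdots\pi(n)$, i.e. $\pi^{-1}(b)<\pi^{-1}(a)$. Cyclomatic number: $\beta(G) = |E(G)| - |V(G)| + \kappa(G)$, where $\kappa(G)$ is the number of connected components of $G$. Reduced words: with $s_i=(i,i+1)$ for $1\le i\le n-1$, the Coxeter length $\ell(\pi)$ is the minimum number of simple reflections $s_i$ in a product expression for $\pi$. A reduced word for $\pi$ is a sequence $i_1 i_2\cdots i_m$ with $m=\ell(\pi)$ and $\pi=s_{i_1}s_{i_2}\cdots s_{i_m}$ (products composed from right to left). The number of repeated letters in a word $i_1\cdots i_m$ is the number of occurrences of letters past the first occurrence of each distinct letter, i.e. $m$ minus the number of distinct letters $|\{i_1,\dots,i_m\}|$. *)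

theory Defs
  imports "HOL-Combinatorics.Permutations" "Graph_Theory.Digraph_Component"
begin

section \<open>Inversion graphs and the cyclomatic number\<close>

text \<open>
  Elements of the symmetric group on \<open>{1..n}\<close> are functions \<open>p\<close> with \<open>p permutes {1..n}\<close>;
  such a function is the identity outside \<open>{1..n}\<close>.

  As usual in \<^theory>\<open>Graph_Theory.Digraph\<close>, a simple graph is a finite, loop-free, symmetric
  digraph (locale \<^locale>\<open>pair_graph\<close>): an undirected edge is represented by its two arcs.
  The vertices of the inversion graph are the values of the permutation; \<open>inv p a\<close> is
  the position of the value \<open>a\<close> in one-line notation.
\<close>

definition inverted_values :: "(nat \<Rightarrow> nat) \<Rightarrow> nat \<Rightarrow> nat \<Rightarrow> bool" where
  "inverted_values p a b \<longleftrightarrow> a < b \<and> inv p b < inv p a"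

definition inversion_graph :: "nat \<Rightarrow> (nat \<Rightarrow> nat) \<Rightarrow> nat pair_pre_digraph" where
  "inversion_graph n p =
     \<lparr> pverts = {1..n},
       parcs = {(a, b). a \<in> {1..n} \<and> b \<in> {1..n} \<and>
                        (inverted_values p a b \<or> inverted_values p b a)} \<rparr>"

lemma pair_graph_inversion_graph: "pair_graph (inversion_graph n p)"
proof -
  have "finite (parcs (inversion_graph n p))"
    by (rule finite_subset[of _ "{1..n} \<times> {1..n}"]) (auto simp: inversion_graph_def)
  then show ?thesis
    by unfold_locales
      (auto simp: inversion_graph_def inverted_values_def symmetric_def intro!: symI)
qed

text \<open>Undirected edges: the two arcs \<open>(u, v)\<close> and \<open>(v, u)\<close> give the same edge \<open>{u, v}\<close>.\<close>

definition edges :: "'a pair_pre_digraph \<Rightarrow> 'a set set" where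
  "edges G = {{u, v} | u v. (u, v) \<in> parcs G}"

text \<open>
  The number of connected components. For a symmetric digraph reachability is symmetric, so the
  strongly connected components \<^const>\<open>pre_digraph.sccs\<close> of the library (the maximal strongly
  connected induced subgraphs) are the connected components of the undirected graph.
\<close>

definition num_components :: "'a pair_pre_digraph \<Rightarrow> nat" where
  "num_components G = card (pre_digraph.sccs (with_proj G))"

definition cyclomatic_number :: "'a pair_pre_digraph \<Rightarrow> int" where
  "cyclomatic_number G = int (card (edges G)) - int (card (pverts G)) + int (num_components G)"


section \<open>Words in the simple reflections\<close>

text \<open>\<open>Transposition.transpose\<close> is qualified because of the list function of the same name.\<close>

definition simple_reflection :: "nat \<Rightarrow> nat \<Rightarrow> nat" where
  "simple_reflection i = Transposition.transpose i (i + 1)"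

text \<open>Products are composed from right to left, i.e. they are compositions of functions.\<close>

definition word_product :: "nat list \<Rightarrow> nat \<Rightarrow> nat" where
  "word_product w = foldr (\<circ>) (map simple_reflection w) id"

definition is_word_for :: "nat \<Rightarrow> (nat \<Rightarrow> nat) \<Rightarrow> nat list \<Rightarrow> bool" where
  "is_word_for n p w \<longleftrightarrow> (\<forall>i \<in> set w. 1 \<le> i \<and> i \<le> n - 1) \<and> word_product w = p"

definition coxeter_length :: "nat \<Rightarrow> (nat \<Rightarrow> nat) \<Rightarrow> nat" where
  "coxeter_length n p = (LEAST m. \<exists>w. is_word_for n p w \<and> length w = m)"

definition reduced_word :: "nat \<Rightarrow> (nat \<Rightarrow> nat) \<Rightarrow> nat list \<Rightarrow> bool" where
  "reduced_word n p w \<longleftrightarrow> is_word_for n p w \<and> length w = coxeter_length n p"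

text \<open>Positions whose letter has already occurred at an earlier position.\<close>

definition repeated_letters :: "'a list \<Rightarrow> nat" where
  "repeated_letters w = card {j. j < length w \<and> w ! j \<in> set (take j w)}"

lemma repeated_letters_eq: "repeated_letters w = length w - card (set w)"
proof -
  have "repeated_letters w + card (set w) = length w"
  proof (induction w rule: rev_induct)
    case Nil
    then show ?case by (simp add: repeated_letters_def)
  next
    case (snoc x xs)
    let ?R = "\<lambda>w. {j. j < length w \<and> w ! j \<in> set (take j w)}"
    have "?R (xs @ [x]) = (if x \<in> set xs then insert (length xs) (?R xs) else ?R xs)"
      by (auto simp: nth_append less_Suc_eq)
    then have "repeated_letters (xs @ [x]) = repeated_letters xs + (if x \<in> set xs then 1 else 0)"
      by (simp add: repeated_letters_def)
    with snoc show ?case by (auto simp: insert_absorb)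
  qed
  then show ?thesis by simp
qed

end

theory Submission
  imports Defs
begin

text \<open>
  Let \<open>w\<close> be a reduced word for \<open>\<pi>\<close>. It has \<open>length w - card (set w)\<close> repeated letters, while
  \<open>\<beta>(G) = card E - (n - \<kappa>)\<close>. The two differences agree term by term.

  \<^item> The length of \<open>w\<close> is the number of edges. Multiplying a permutation on the right by a simple
    reflection swaps two neighbouring entries of the one-line notation and hence adds or removes
    exactly one inversion (\<open>inversions_ascent\<close>, \<open>inversions_descent\<close>). So every word is at least as
    long as the number of inversions, and undoing one descent after another produces a word for which
    equality holds (\<open>length_reduced_word\<close>).

  \<^item> The number of distinct letters is \<open>n - \<kappa>\<close>. The link is the notion of a cut \<open>i\<close> being crossed: some
    inversion has one value at most \<open>i\<close> and the other above \<open>i\<close>. A letter that is absent from a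
    word leaves \<open>{..i}\<close> invariant, so its cut is not crossed. In a reduced word inversions are only
    ever gained from one prefix to the next, and the first use of a letter \<open>i\<close> creates one that
    crosses the cut \<open>i\<close>; so the letters of a reduced word are exactly the crossed cuts
    (\<open>crossed_imp_letter\<close>, \<open>letter_imp_crossed\<close>). In the graph, a cut that is not crossed
    separates the values on its two sides, and one crossing inversion already suffices to connect
    \<open>i\<close> with \<open>i + 1\<close> (\<open>crossed_imp_reachable\<close>). Hence the components are the intervals between
    consecutive cuts that are not crossed, and their minima are counted in
    \<open>num_components_inversion_graph\<close>.
\<close>

section \<open>Inversions and right multiplication by a simple reflection\<close>

definition inversions :: "(nat \<Rightarrow> nat) \<Rightarrow> (nat \<times> nat) set" where
  "inversions p = {(a, b). inverted_values p a b}"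

lemma inversions_subset:
  assumes "p permutes {1..n}"
  shows "inversions p \<subseteq> {1..n} \<times> {1..n}"
proof -
  have q: "inv p permutes {1..n}"
    using assms by (rule permutes_inv)
  have out: "inv p x = x" if "x \<notin> {1..n}" for x
    using q that by (rule permutes_not_in)
  have ins: "inv p x \<in> {1..n}" if "x \<in> {1..n}" for x
    using permutes_in_image[OF q] that by blast
  show ?thesis
  proof (clarsimp simp only: inversions_def inverted_values_def)
    fix a b assume ab: "a < b" "inv p b < inv p a"
    have "b \<le> n"
      using ab out[of a] out[of b] ins[of a] by (cases "a \<in> {1..n}") force+
    moreover have "a \<noteq> 0"
      using ab out[of 0] by (cases a) auto
    ultimately show "a \<in> {1..n} \<and> b \<in> {1..n}"
      using ab by auto
  qed
qed

lemma finite_inversions: "p permutes {1..n} \<Longrightarrow> finite (inversions p)"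
  using inversions_subset finite_subset by blast

lemma simple_reflection_involutive: "simple_reflection i \<circ> simple_reflection i = id"
  by (simp add: simple_reflection_def)

lemma bij_simple_reflection: "bij (simple_reflection i)"
  by (simp add: simple_reflection_def)

text \<open>
  The positions of all values other than the two entries at \<open>i\<close> and \<open>i + 1\<close> stay where they are, and
  no position lies between \<open>i\<close> and \<open>i + 1\<close>. So the swap changes the relative order of just one
  pair of values.
\<close>

lemma inversions_ascent:
  assumes "bij q" and "q i < q (Suc i)"
  shows "inversions (q \<circ> simple_reflection i) = insert (q i, q (Suc i)) (inversions q)"
    and "(q i, q (Suc i)) \<notin> inversions q"
proof -
  have inv_q: "inv q (q x) = x" "q (inv q x) = x" for x
    using assms(1) by (simp_all add: bij_is_inj bij_is_surj surj_f_inv_f)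
  show "(q i, q (Suc i)) \<notin> inversions q"
    by (simp add: inversions_def inverted_values_def inv_q)
  let ?s = "simple_reflection i"
  have "inv (q \<circ> ?s) = ?s \<circ> inv q"
    using assms(1) by (simp add: o_inv_distrib simple_reflection_def)
  then have *: "inverted_values (q \<circ> ?s) a b \<longleftrightarrow> a < b \<and> ?s (inv q b) < ?s (inv q a)" for a b
    by (simp add: inverted_values_def)
  \<comment> \<open>The condition \<open>a < b\<close> and the ascent exclude that \<open>a\<close> and \<open>b\<close> are the two swapped values in
      reversed order, which is the second case.\<close>
  have "inverted_values (q \<circ> ?s) a b \<longleftrightarrow> a = q i \<and> b = q (Suc i) \<or> inverted_values q a b" for a b
  proof -
    define x y where "x = inv q a" and "y = inv q b"
    have ab: "a = q x" "b = q y"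
      by (simp_all add: x_def y_def inv_q)
    have eq: "a = q i \<longleftrightarrow> x = i" "b = q (Suc i) \<longleftrightarrow> y = Suc i"
      by (simp_all add: ab inj_eq bij_is_inj[OF assms(1)])
    consider "x = i" "y = Suc i" | "x = Suc i" "y = i" | "\<not> (x = i \<and> y = Suc i)" "\<not> (x = Suc i \<and> y = i)"
      by blast
    then show ?thesis
    proof cases
      case 1
      then show ?thesis
        unfolding * using assms(2) ab
        by (simp add: inv_q simple_reflection_def)
    next
      case 2
      then show ?thesis
        unfolding * unfolding inverted_values_def eq using assms(2) ab by simp
    next
      case 3
      then have "?s y < ?s x \<longleftrightarrow> y < x"
        by (auto simp: simple_reflection_def transpose_def)
      with 3 show ?thesis
        unfolding * unfolding inverted_values_def eq x_def[symmetric] y_def[symmetric] by auto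
    qed
  qed
  then show "inversions (q \<circ> ?s) = insert (q i, q (Suc i)) (inversions q)"
    by (auto simp: inversions_def)
qed

text \<open>
  Since \<open>s\<^sub>i\<close> is an involution, this is the ascent case for \<open>q \<circ> s\<^sub>i\<close>.
\<close>

lemma inversions_descent:
  assumes "bij q" and "q (Suc i) < q i"
  shows "inversions q = insert (q (Suc i), q i) (inversions (q \<circ> simple_reflection i))"
    and "(q (Suc i), q i) \<notin> inversions (q \<circ> simple_reflection i)"
proof -
  let ?s = "simple_reflection i"
  have "bij (q \<circ> ?s)"
    using bij_simple_reflection assms(1) by (rule bij_comp)
  moreover have "(q \<circ> ?s) i = q (Suc i)" "(q \<circ> ?s) (Suc i) = q i"
    by (simp_all add: simple_reflection_def)
  moreover have "(q \<circ> ?s) \<circ> ?s = q"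
    by (simp add: comp_assoc simple_reflection_involutive)
  ultimately show "inversions q = insert (q (Suc i), q i) (inversions (q \<circ> ?s))"
    and "(q (Suc i), q i) \<notin> inversions (q \<circ> ?s)"
    using assms(2) inversions_ascent[of "q \<circ> ?s" i] by simp_all
qed

section \<open>The length of a reduced word is the number of inversions\<close>

lemma word_product_Nil: "word_product [] = id"
  by (simp add: word_product_def)

lemma word_product_snoc: "word_product (w @ [i]) = word_product w \<circ> simple_reflection i"
proof -
  have "foldr (\<circ>) fs g = foldr (\<circ>) fs id \<circ> g" for fs :: "(nat \<Rightarrow> nat) list" and g :: "nat \<Rightarrow> nat"
    by (induction fs) (simp_all add: comp_assoc)
  from this[of _ "simple_reflection i"] show ?thesis
    by (simp add: word_product_def)
qed

lemma bij_word_product: "bij (word_product w)"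
proof (induction w rule: rev_induct)
  case Nil
  show ?case
    unfolding word_product_Nil by (rule bij_id)
next
  case (snoc i w)
  show ?case
    unfolding word_product_snoc using bij_simple_reflection snoc by (rule bij_comp)
qed

lemma inversions_id: "inversions id = {}"
  by (auto simp: inversions_def inverted_values_def)

lemma card_inversions_word_product_le:
  "finite (inversions (word_product w)) \<and> card (inversions (word_product w)) \<le> length w"
proof (induction w rule: rev_induct)
  case Nil
  show ?case
    unfolding word_product_Nil inversions_id by simp
next
  case (snoc i w)
  let ?q = "word_product w"
  have "?q i \<noteq> ?q (Suc i)"
    using bij_word_product[of w] by (metis bij_pointE n_not_Suc_n)
  then consider "?q i < ?q (Suc i)" | "?q (Suc i) < ?q i"
    by linarith
  then show ?case
  proof cases
    case 1
    note asc = inversions_ascent[OF bij_word_product 1]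
    show ?thesis
      unfolding word_product_snoc asc(1) using snoc asc(2) by simp
  next
    case 2
    then have sub: "inversions (word_product (w @ [i])) \<subseteq> inversions ?q"
      unfolding word_product_snoc using inversions_descent(1)[OF bij_word_product] by blast
    then have "card (inversions (word_product (w @ [i]))) \<le> card (inversions ?q)"
      using snoc card_mono by blast
    with sub snoc show ?thesis
      by (auto intro: finite_subset)
  qed
qed

text \<open>
  An increasing bijection and its inverse both move no number down.
\<close>

lemma bij_without_descent_eq_id:
  fixes p :: "nat \<Rightarrow> nat"
  assumes "bij p" and "\<And>i. p i \<le> p (Suc i)"
  shows "p = id"
proof -
  have "p i < p (Suc i)" for i
    using assms by (metis bij_pointE le_neq_implies_less n_not_Suc_n)
  then have mono: "strict_mono p"
    by (simp add: strict_mono_Suc_iff)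
  have "p (inv p x) = x" for x
    using assms(1) by (simp add: bij_is_surj surj_f_inv_f)
  then have "strict_mono (inv p)"
    using mono by (metis strict_mono_def strict_mono_less)
  then have "p x \<le> inv p (p x)" for x
    by (rule strict_mono_imp_increasing)
  moreover have "inv p (p x) = x" for x
    using assms(1) by (simp add: bij_is_inj)
  ultimately have "p x \<le> x" for x
    by metis
  then show ?thesis
    using strict_mono_imp_increasing[OF mono] by (intro ext) (simp add: antisym)
qed

text \<open>
  This is bubble sort: each exchange of a descent removes one inversion, and only the identity has
  no descent.
\<close>

lemma exists_word_of_length_card_inversions:
  assumes "p permutes {1..n}"
  shows "\<exists>w. is_word_for n p w \<and> length w = card (inversions p)"
  using assms
proof (induction "card (inversions p)" arbitrary: p rule: less_induct)
  case less
  have bij: "bij p"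
    using less.prems by (rule permutes_bij)
  show ?case
  proof (cases "\<exists>i. p (Suc i) < p i")
    case False
    then have "p = id"
      using bij_without_descent_eq_id[OF bij] by (meson not_less)
    then show ?thesis
      by (intro exI[of _ "[]"]) (simp add: is_word_for_def word_product_Nil inversions_id)
  next
    case True
    then obtain i where i: "p (Suc i) < p i"
      by blast
    have out: "p x = x" if "x \<notin> {1..n}" for x
      using less.prems that by (rule permutes_not_in)
    have ins: "p x \<le> n" if "x \<in> {1..n}" for x
      using permutes_in_image[OF less.prems] that by force
    \<comment> \<open>Outside \<open>{1..n}\<close> the permutation is the identity, so a descent can only occur at a position
        that is an admissible letter.\<close>
    have "i \<noteq> 0"
      using i out[of 0] by (cases i) auto
    moreover have "Suc i \<le> n"
      using i out[of i] out[of "Suc i"] ins[of i] by (cases "i \<in> {1..n}") force+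
    ultimately have letter: "1 \<le> i" "i \<le> n - 1" "Suc i \<in> {1..n}" "i \<in> {1..n}"
      by auto
    let ?q = "p \<circ> simple_reflection i"
    have q: "?q permutes {1..n}"
      using less.prems letter
      by (auto intro!: permutes_compose permutes_swap_id simp: simple_reflection_def)
    have card: "card (inversions p) = Suc (card (inversions ?q))"
      using inversions_descent[OF bij i] finite_inversions[OF q] by simp
    then obtain w where w: "is_word_for n ?q w" "length w = card (inversions ?q)"
      using less.hyps q by force
    have "word_product (w @ [i]) = p"
      using w(1)
      by (simp add: is_word_for_def word_product_snoc comp_assoc simple_reflection_involutive)
    then have "is_word_for n p (w @ [i])"
      using w(1) letter by (auto simp: is_word_for_def)
    then show ?thesis
      using w(2) card by (intro exI[of _ "w @ [i]"]) simp
  qed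
qed

lemma length_reduced_word:
  assumes "p permutes {1..n}" and "reduced_word n p w"
  shows "length w = card (inversions p)"
proof (rule antisym)
  have w: "word_product w = p" "length w = coxeter_length n p"
    using assms(2) by (simp_all add: reduced_word_def is_word_for_def)
  show "card (inversions p) \<le> length w"
    using card_inversions_word_product_le[of w] unfolding w(1) by blast
  have "coxeter_length n p \<le> card (inversions p)"
    unfolding coxeter_length_def
    by (rule Least_le) (rule exists_word_of_length_card_inversions[OF assms(1)])
  then show "length w \<le> card (inversions p)"
    by (simp only: w(2))
qed

section \<open>Letters of a word and inversions across a cut\<close>

definition crossed :: "(nat \<Rightarrow> nat) \<Rightarrow> nat \<Rightarrow> bool" where
  "crossed p i \<longleftrightarrow> (\<exists>(a, b) \<in> inversions p. a \<le> i \<and> i < b)"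

text \<open>
  Among the simple reflections only \<open>s\<^sub>i\<close> moves a number across the cut between \<open>i\<close> and \<open>i + 1\<close>.
\<close>

lemma word_product_preserves_cut:
  assumes "i \<notin> set w"
  shows "word_product w x \<le> i \<longleftrightarrow> x \<le> i"
  using assms
proof (induction w arbitrary: x rule: rev_induct)
  case Nil
  show ?case
    unfolding word_product_Nil by simp
next
  case (snoc j w)
  then have "word_product w (simple_reflection j x) \<le> i \<longleftrightarrow> simple_reflection j x \<le> i"
    by simp
  also have "\<dots> \<longleftrightarrow> x \<le> i"
    using snoc.prems by (auto simp: simple_reflection_def transpose_def)
  finally show ?case
    unfolding word_product_snoc comp_apply .
qed

lemma crossed_imp_letter:
  assumes "crossed (word_product w) i"
  shows "i \<in> set w"
proof (rule ccontr)
  assume "i \<notin> set w"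
  then have "inv (word_product w) x \<le> i \<longleftrightarrow> x \<le> i" for x
    using word_product_preserves_cut bij_word_product[of w] by (metis bij_inv_eq_iff)
  with assms show False
    unfolding crossed_def inversions_def inverted_values_def
    by clarsimp (meson le_less_trans less_imp_le not_le)
qed

text \<open>
  The first hypothesis says that the word is as short as possible, so no step may lose an inversion,
  and it suffices that a crossing inversion appears at some point. It does when \<open>i\<close> is used for
  the first time: the product \<open>q\<close> of the preceding letters still preserves the cut, so that the new
  inversion \<open>(q i, q (i + 1))\<close> has its two values on different sides of it.
\<close>

lemma letter_imp_crossed:
  assumes "length w = card (inversions (word_product w))" and "i \<in> set w"
  shows "crossed (word_product w) i"
  using assms
proof (induction w rule: rev_induct)
  case (snoc j w)
  let ?q = "word_product w"
  have le: "finite (inversions ?q)" "card (inversions ?q) \<le> length w"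
    using card_inversions_word_product_le by blast+
  \<comment> \<open>A descent would leave fewer inversions than letters.\<close>
  have "?q j < ?q (Suc j)"
  proof (rule ccontr)
    assume "\<not> ?q j < ?q (Suc j)"
    then have "?q (Suc j) < ?q j"
      using bij_word_product[of w] by (metis bij_pointE linorder_neqE_nat n_not_Suc_n)
    then have "inversions (word_product (w @ [j])) \<subseteq> inversions ?q"
      unfolding word_product_snoc using inversions_descent(1)[OF bij_word_product] by blast
    then have "card (inversions (word_product (w @ [j]))) \<le> length w"
      using le card_mono order_trans by blast
    then show False
      using snoc.prems(1) by simp
  qed
  note asc = inversions_ascent[OF bij_word_product this]
  have reduced: "length w = card (inversions ?q)"
    using snoc.prems(1) le(1) asc(2) unfolding word_product_snoc asc(1) by simp
  show ?case
  proof (cases "i \<in> set w")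
    case True
    then have "crossed ?q i"
      using snoc.IH reduced by blast
    then show ?thesis
      unfolding crossed_def word_product_snoc asc(1) by auto
  next
    case False
    with snoc.prems(2) have "j = i" by simp
    then have "?q j \<le> i" "i < ?q (Suc j)"
      using word_product_preserves_cut[OF False, of i] word_product_preserves_cut[OF False, of "Suc i"]
      by auto
    then show ?thesis
      unfolding crossed_def word_product_snoc asc(1) by auto
  qed
qed simp

section \<open>Edges and components of the inversion graph\<close>

lemma card_edges_inversion_graph:
  assumes "p permutes {1..n}"
  shows "card (edges (inversion_graph n p)) = card (inversions p)"
proof -
  have "edges (inversion_graph n p) = (\<lambda>(a, b). {a, b}) ` inversions p"
    using inversions_subset[OF assms]
    by (fastforce simp: edges_def inversion_graph_def inversions_def insert_commute)
  moreover have "inj_on (\<lambda>(a, b). {a, b}) (inversions p)"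
    by (auto simp: inj_on_def inversions_def inverted_values_def doubleton_eq_iff)
  ultimately show ?thesis
    by (simp add: card_image)
qed

context
  fixes n :: nat and p :: "nat \<Rightarrow> nat"
  assumes perm: "p permutes {1..n}"
begin

interpretation G: pair_graph "inversion_graph n p"
  by (rule pair_graph_inversion_graph)

lemma parcs_inversion_graph_iff:
  "(a, b) \<in> parcs (inversion_graph n p) \<longleftrightarrow> (a, b) \<in> inversions p \<or> (b, a) \<in> inversions p"
  using inversions_subset[OF perm] by (auto simp: inversion_graph_def inversions_def)

text \<open>
  Let the inversion \<open>(u, v)\<close> cross the cut, so that \<open>u \<le> i < v\<close> and \<open>v\<close> stands to the left of \<open>u\<close>.
  A value strictly between \<open>u\<close> and \<open>v\<close> stands to the left of \<open>u\<close> or to the right of \<open>v\<close>, and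
  is thus adjacent to \<open>u\<close> or to \<open>v\<close>. So \<open>i\<close> and \<open>i + 1\<close> both lie in the component of the edge
  \<open>{u, v}\<close>.
\<close>

lemma crossed_imp_reachable:
  assumes "crossed p i"
  shows "i \<rightarrow>\<^sup>*\<^bsub>with_proj (inversion_graph n p)\<^esub> Suc i"
proof -
  obtain u v where uv: "(u, v) \<in> inversions p" "u \<le> i" "i < v"
    using assms by (auto simp: crossed_def)
  then have verts: "u \<in> {1..n}" "v \<in> {1..n}"
    using inversions_subset[OF perm] by blast+
  have pos: "inv p v < inv p u"
    using uv(1) by (simp add: inversions_def inverted_values_def)
  let ?R = "\<lambda>a b. a \<rightarrow>\<^sup>*\<^bsub>with_proj (inversion_graph n p)\<^esub> b"
  have edge: "?R a b \<and> ?R b a" if "a < b" "inv p b < inv p a" for a b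
    using that by (intro conjI G.reachable_adjI)
      (simp_all add: parcs_inversion_graph_iff inversions_def inverted_values_def)
  have refl: "?R a a" if "a \<in> {1..n}" for a
    using that by (intro G.reachable_refl) (simp add: inversion_graph_def)
  have inj: "inv p a \<noteq> inv p b" if "a \<noteq> b" for a b
    using that permutes_inj[OF permutes_inv[OF perm]] by (auto dest: injD)
  have "?R u v \<and> ?R v u"
    using edge pos uv by simp
  moreover have "?R i u \<or> ?R i v"
  proof (cases "i = u \<or> inv p u < inv p i")
    case True
    then show ?thesis
      using refl verts edge[of i v] uv pos by auto
  next
    case False
    then show ?thesis
      using edge[of u i] uv inj[of i u] by auto
  qed
  moreover have "?R u (Suc i) \<or> ?R v (Suc i)"
  proof (cases "Suc i = v \<or> inv p (Suc i) < inv p v")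
    case True
    then show ?thesis
      using refl verts edge[of u "Suc i"] uv pos by auto
  next
    case False
    then show ?thesis
      using edge[of "Suc i" v] uv inj[of "Suc i" v] by auto
  qed
  ultimately show ?thesis
    by (meson G.reachable_trans)
qed

lemma reachable_same_side_of_uncrossed:
  assumes "a \<rightarrow>\<^sup>*\<^bsub>with_proj (inversion_graph n p)\<^esub> b" and "\<not> crossed p i"
  shows "a \<le> i \<longleftrightarrow> b \<le> i"
  using assms(1)
proof (induction rule: G.reachable_induct)
  case (step x y)
  then have "(x, y) \<in> inversions p \<or> (y, x) \<in> inversions p"
    by (simp add: parcs_inversion_graph_iff)
  moreover from this have "x < y \<and> (x, y) \<in> inversions p \<or> y < x \<and> (y, x) \<in> inversions p"
    by (auto simp: inversions_def inverted_values_def)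
  ultimately have "x \<le> i \<longleftrightarrow> y \<le> i"
    using assms(2) unfolding crossed_def by fastforce
  with step.IH show ?case
    by simp
qed simp

text \<open>
  Each component is represented by its least value, and \<open>m\<close> is least in its component if and only if
  the cut below \<open>m\<close> is not crossed. The value \<open>1\<close> always qualifies, as no inversion crosses
  the cut \<open>0\<close>.
\<close>

lemma num_components_inversion_graph:
  "num_components (inversion_graph n p) = card {m \<in> {1..n}. \<not> crossed p (m - 1)}"
proof -
  let ?S = "{m \<in> {1..n}. \<not> crossed p (m - 1)}"
  have verts: "pverts (inversion_graph n p) = {1..n}"
    by (simp add: inversion_graph_def)
  have "inj_on G.scc_of ?S"
  proof (rule linorder_inj_onI)
    fix a b assume ab: "a < b" "a \<in> ?S" "b \<in> ?S"
    show "G.scc_of a \<noteq> G.scc_of b"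
    proof
      assume "G.scc_of a = G.scc_of b"
      moreover have "a \<in> G.scc_of a"
        using ab(2) by (intro G.in_scc_of_self) (simp only: with_proj_simps verts mem_Collect_eq)
      ultimately have "a \<in> G.scc_of b"
        by simp
      then have "a \<rightarrow>\<^sup>*\<^bsub>with_proj (inversion_graph n p)\<^esub> b"
        by (simp add: G.scc_of_def)
      then show False
        using reachable_same_side_of_uncrossed[of a b "b - 1"] ab by auto
    qed
  qed auto
  moreover have "G.scc_of m \<in> G.scc_of ` ?S" if "m \<in> {1..n}" for m
    using that
  proof (induction m)
    case (Suc m)
    show ?case
    proof (cases "crossed p m")
      case False
      then show ?thesis
        using Suc.prems by auto
    next
      case True
      then have reach: "m \<rightarrow>\<^sup>*\<^bsub>with_proj (inversion_graph n p)\<^esub> Suc m"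
        by (rule crossed_imp_reachable)
      then have "m \<in> {1..n}"
        using G.reachable_in_verts(1)[OF reach] unfolding with_proj_simps verts by simp
      moreover have "G.scc_of m = G.scc_of (Suc m)"
        using reach by (intro G.scc_of_eq G.scc_ofI_reachable)
      ultimately show ?thesis
        using Suc.IH by simp
    qed
  qed simp
  then have "G.sccs_verts = G.scc_of ` ?S"
    unfolding G.sccs_verts_conv_scc_of with_proj_simps verts by blast
  ultimately show ?thesis
    by (simp add: num_components_def G.card_sccs_verts[symmetric] card_image)
qed

end

section \<open>Repeated letters and the cyclomatic number\<close>

theorem theorem1p1:
  fixes n :: nat and \<pi> :: "nat \<Rightarrow> nat" and w :: "nat list"
  assumes "n \<ge> 1"
    and "\<pi> permutes {1..n}"
    and "reduced_word n \<pi> w"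
  shows "int (repeated_letters w) = cyclomatic_number (inversion_graph n \<pi>)"
proof -
  have w: "word_product w = \<pi>" "set w \<subseteq> {1..n - 1}"
    using assms(3) by (auto simp: reduced_word_def is_word_for_def)
  have len: "length w = card (inversions \<pi>)"
    using assms(2,3) by (rule length_reduced_word)
  then have letters: "crossed \<pi> i \<longleftrightarrow> i \<in> set w" for i
    using crossed_imp_letter[of w i] letter_imp_crossed[of w i] w(1) by blast
  \<comment> \<open>The letter \<open>i\<close> excludes \<open>i + 1\<close> from the component minima.\<close>
  have "{m \<in> {1..n}. \<not> crossed \<pi> (m - 1)} = {1..n} - Suc ` set w"
    unfolding letters using w(2) by (force simp: image_iff)
  moreover have "Suc ` set w \<subseteq> {1..n}"
    using w(2) by fastforce
  ultimately have "num_components (inversion_graph n \<pi>) = n - card (set w)"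
    using num_components_inversion_graph[OF assms(2)] by (simp add: card_Diff_subset card_image)
  moreover have "card (set w) \<le> n"
    using card_mono[OF _ w(2)] by simp
  ultimately show ?thesis
    using card_edges_inversion_graph[OF assms(2)] len card_length[of w]
    by (simp add: cyclomatic_number_def repeated_letters_eq inversion_graph_def)
qed

end
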